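(* Let $X$ and $Z$ be real Hilbert spaces, $K:X\to X$, $N:X\to X$ and $H:Z\to X$ operators, and consider the system $x=KNx+Hu$, $u\in Z$, with solution operator $Tu=[I-KN]^{-1}Hu$, and the cost functional $$J(u)=(u,Ru)+(x,Wx),\qquad x=Tu,$$ where $R:Z\to Z$ is a bounded linear symmetric, strictly monotone and coercive operator and $W:X\to X$ is a bounded linear symmetric monotone operator. Suppose that: (a) $K$, $N$ and $H$ are Fréchet differentiable with $K'(x)=K$ and $N'(x)=G(x)$ for all $x\in X$, and $H'(u)=H$ for all $u\in Z$; (b) $[I-KG(x)]^{-1}$ exists as a bounded linear operator for all $x=Tu$, $u\in Z$. Then the optimality system for the problem of minimizing $J$ over $Z$ is $$x^*=KNx^*+Hu^*,$$ $$u^*=-R^{-1}H^*\big([I-KG(x^* )]^{*}\big)^{-1}Wx^*,$$ that is, an optimal pair $(u^*,x^* )$ satisfies these two equations.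
   Context: Standing assumption: for each $u\in Z$ the equation $x=KNx+Hu$ has a unique solution $x\in X$; $T:Z\to X$ denotes $u\mapsto x$. An optimal pair is $(u^*,x^* )$ with $x^*=Tu^*$ and $J(u^* )=\inf_{u\in Z}J(u)$. Hilbert spaces are identified with their duals. Coercive means $(u,Ru)/\|u\|\to\infty$ as $\|u\|\to\infty$; under the assumptions on $R$ the inverse $R^{-1}$ exists as a bounded linear operator. For an operator, the superscript $*$ denotes its adjoint (on $u^*,x^*$ it only marks optimality).
   Formalization: The formal statement adds the hypothesis that the solution operator T is continuous at the optimal control u*; with N only pointwise Fréchet differentiable the claim fails in infinite dimensions. Continuity is automatic if N is continuously differentiable or X is finite-dimensional. *)

theory Defs
  imports "HOL-Analysis.Analysis"
begin

text \<open>Real Hilbert spaces are types of sort \<open>{real_inner, complete_space}\<close>; adjoints are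
  the library's \<^const>\<open>adjoint\<close>.\<close>

definition symmetric_operator :: "('a::real_inner \<Rightarrow> 'a) \<Rightarrow> bool" where
  "symmetric_operator A \<longleftrightarrow> (\<forall>x y. A x \<bullet> y = x \<bullet> A y)"

definition monotone_operator :: "('a::real_inner \<Rightarrow> 'a) \<Rightarrow> bool" where
  "monotone_operator A \<longleftrightarrow> (\<forall>x y. 0 \<le> (A x - A y) \<bullet> (x - y))"

definition strictly_monotone_operator :: "('a::real_inner \<Rightarrow> 'a) \<Rightarrow> bool" where
  "strictly_monotone_operator A \<longleftrightarrow> (\<forall>x y. x \<noteq> y \<longrightarrow> 0 < (A x - A y) \<bullet> (x - y))"

definition coercive_operator :: "('a::real_inner \<Rightarrow> 'a) \<Rightarrow> bool" where
  "coercive_operator A \<longleftrightarrow> filterlim (\<lambda>u. (u \<bullet> A u) / norm u) at_top at_infinity"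

definition has_bounded_inverse :: "('a::real_normed_vector \<Rightarrow> 'b::real_normed_vector) \<Rightarrow> bool" where
  "has_bounded_inverse A \<longleftrightarrow> bij A \<and> bounded_linear (inv A)"

definition uniquely_solvable ::
    "('x::real_inner \<Rightarrow> 'x) \<Rightarrow> ('x \<Rightarrow> 'x) \<Rightarrow> ('z::real_inner \<Rightarrow> 'x) \<Rightarrow> bool" where
  "uniquely_solvable K N H \<longleftrightarrow> (\<forall>u. \<exists>!x. x = K (N x) + H u)"

definition solution_operator ::
    "('x::real_inner \<Rightarrow> 'x) \<Rightarrow> ('x \<Rightarrow> 'x) \<Rightarrow> ('z::real_inner \<Rightarrow> 'x) \<Rightarrow> 'z \<Rightarrow> 'x" where
  "solution_operator K N H u = (THE x. x = K (N x) + H u)"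

definition cost ::
    "('z::real_inner \<Rightarrow> 'z) \<Rightarrow> ('x::real_inner \<Rightarrow> 'x) \<Rightarrow> ('z \<Rightarrow> 'x) \<Rightarrow> 'z \<Rightarrow> real" where
  "cost R W T u = u \<bullet> R u + T u \<bullet> W (T u)"

text \<open>For monotone \<open>R\<close> and \<open>W\<close> with \<open>R 0 = 0\<close> and \<open>W 0 = 0\<close> the cost is bounded below by 0,
  so the real-valued infimum is the genuine one.\<close>

definition optimal_pair ::
    "('z::real_inner \<Rightarrow> 'z) \<Rightarrow> ('x::real_inner \<Rightarrow> 'x) \<Rightarrow> ('z \<Rightarrow> 'x) \<Rightarrow> 'z \<Rightarrow> 'x \<Rightarrow> bool" where
  "optimal_pair R W T u x \<longleftrightarrow> x = T u \<and> cost R W T u = (INF v. cost R W T v)"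

end

theory Submission
  imports Defs
begin

text \<open>At a minimizer the derivative of the cost vanishes, so the whole content lies in two points:
  the solution operator is differentiable at the optimal control, and the resulting variational
  equation can be rewritten with Hilbert space adjoints.

  Differentiability. With \<open>F x = x - K (N x)\<close> the state equation reads \<open>F (T u) = H u\<close>, and
  \<open>A = F' (x\<^sup>*)\<close> has a bounded inverse \<open>B\<close>. Since \<open>T\<close> is a
  solution of this equation that is continuous at \<open>u\<^sup>*\<close>, the expansion of \<open>F\<close> at \<open>x\<^sup>*\<close> first yields
  a Lipschitz estimate for \<open>T\<close> at \<open>u\<^sup>*\<close> and then \<open>T' (u\<^sup>*) = B H\<close>
  (\<open>has_derivative_solution_of_equation\<close>).

  Variational equation. Because \<open>R\<close> and \<open>W\<close> are symmetric, half the derivative of the cost in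
  direction \<open>h\<close> is \<open>h \<bullet> R u\<^sup>* + B (H h) \<bullet> W x\<^sup>*\<close>. Its vanishing for all \<open>h\<close> says
  \<open>R u\<^sup>* = - H\<^sup>* (B\<^sup>* (W x\<^sup>*))\<close>, and \<open>B\<^sup>*\<close> is the inverse of \<open>A\<^sup>*\<close>. Strict monotonicity makes \<open>R\<close>
  injective, so \<open>R\<close> can be cancelled.

  Adjoints of bounded operators between Hilbert spaces exist by the Riesz representation
  theorem (\<open>riesz_representation\<close>), proved by minimizing the quadratic energy
  \<open>x \<bullet> x - 2 * \<phi> x\<close>.\<close>

section \<open>Riesz representation and adjoints in Hilbert spaces\<close>

text \<open>The energy \<open>x \<bullet> x - 2 * \<phi> x\<close> is bounded below, and by the parallelogram law every
  minimizing sequence is Cauchy. The representing vector is the critical point found at its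
  limit.\<close>

lemma riesz_representation:
  fixes \<phi> :: "'a::{real_inner, complete_space} \<Rightarrow> real"
  assumes "bounded_linear \<phi>"
  shows "\<exists>z. \<forall>x. \<phi> x = x \<bullet> z"
proof -
  interpret \<phi>: bounded_linear \<phi> by fact
  define e where "e x = x \<bullet> x - 2 * \<phi> x" for x
  obtain M where M: "\<And>x. norm (\<phi> x) \<le> norm x * M"
    using \<phi>.bounded by blast
  have lower: "- (M\<^sup>2) \<le> e x" for x
  proof -
    have "\<phi> x \<le> norm x * M" using M[of x] by simp
    moreover have "0 \<le> (norm x - M)\<^sup>2" by simp
    ultimately show ?thesis
      by (simp add: e_def power2_eq_square algebra_simps flip: power2_norm_eq_inner)
  qed
  have bdd: "bdd_below (range e)"
    using lower by (rule bdd_belowI2)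
  define m where "m = (INF x. e x)"
  have m_le: "m \<le> e x" for x
    unfolding m_def by (rule cINF_lower[OF bdd]) simp
  have parallelogram: "(norm (x - y))\<^sup>2 \<le> 2 * (e x - m) + 2 * (e y - m)" for x y
  proof -
    define c where "c = (1/2) *\<^sub>R (x + y)"
    have "(norm (x - y))\<^sup>2 = 2 * e x + 2 * e y - 4 * e c"
      by (simp add: e_def c_def power2_norm_eq_inner \<phi>.scaleR \<phi>.add inner_add_left inner_add_right
          inner_diff_left inner_diff_right inner_commute algebra_simps)
    also have "\<dots> \<le> 2 * e x + 2 * e y - 4 * m"
      using m_le[of c] by simp
    finally show ?thesis by simp
  qed
  have "\<exists>x. e x < m + inverse (real (Suc n))" for n
    using cINF_less_iff[OF _ bdd, of "m + inverse (real (Suc n))"] unfolding m_def by auto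
  then obtain X where X: "\<And>n. e (X n) < m + inverse (real (Suc n))"
    by metis
  have "Cauchy X"
  proof (rule metric_CauchyI)
    fix r :: real assume "r > 0"
    then obtain k where k: "inverse (real (Suc k)) < r\<^sup>2 / 4"
      using reals_Archimedean[of "r\<^sup>2 / 4"] by auto
    have near: "e (X i) - m < r\<^sup>2 / 4" if "i \<ge> k" for i
    proof -
      have "inverse (real (Suc i)) \<le> inverse (real (Suc k))" using that by simp
      then show ?thesis using X[of i] k by linarith
    qed
    have "dist (X i) (X j) < r" if "i \<ge> k" "j \<ge> k" for i j
    proof -
      have "(norm (X i - X j))\<^sup>2 < r\<^sup>2"
        using parallelogram[of "X i" "X j"] near[OF that(1)] near[OF that(2)] by argo
      then show ?thesis
        using \<open>r > 0\<close> by (simp add: dist_norm power_less_imp_less_base)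
    qed
    then show "\<exists>k. \<forall>i\<ge>k. \<forall>j\<ge>k. dist (X i) (X j) < r" by blast
  qed
  then obtain z where z: "X \<longlonglongrightarrow> z"
    using Cauchy_convergent convergent_def by blast
  have "(\<lambda>n. e (X n)) \<longlonglongrightarrow> e z"
    unfolding e_def by (intro tendsto_intros \<phi>.tendsto z)
  moreover have "(\<lambda>n. m + inverse (real (Suc n))) \<longlonglongrightarrow> m + 0"
    by (intro tendsto_intros LIMSEQ_inverse_real_of_nat)
  ultimately have "e z \<le> m + 0"
    by (rule LIMSEQ_le) (use X less_imp_le in blast)
  then have min: "\<forall>y\<in>UNIV. e z \<le> e y"
    using m_le by (auto intro: order_trans)
  have "(e has_derivative (\<lambda>h. z \<bullet> h + h \<bullet> z - 2 * \<phi> h)) (at z)"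
    unfolding e_def
    by (auto intro!: derivative_eq_intros bounded_linear_imp_has_derivative[OF assms])
  then have zero: "(\<lambda>h. z \<bullet> h + h \<bullet> z - 2 * \<phi> h) = (\<lambda>h. 0)"
    using differential_zero_maxmin[of z UNIV e] min by blast
  have "\<phi> h = h \<bullet> z" for h
    using fun_cong[OF zero, of h] by (simp add: inner_commute)
  then show ?thesis by blast
qed

text \<open>\<^const>\<open>adjoint\<close> is a choice among maps satisfying the adjoint equation; Riesz representation
  of each functional \<open>x \<mapsto> A x \<bullet> y\<close> shows that such a map exists.\<close>

lemma inner_adjoint:
  fixes A :: "'a::{real_inner, complete_space} \<Rightarrow> 'b::real_inner"
  assumes "bounded_linear A"
  shows "A x \<bullet> y = x \<bullet> adjoint A y"
proof -
  have "\<exists>z. \<forall>x. A x \<bullet> y = x \<bullet> z" for y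
    using riesz_representation[OF bounded_linear_compose[OF bounded_linear_inner_left assms]]
    by auto
  then have "\<exists>A'. \<forall>x y. A x \<bullet> y = x \<bullet> A' y"
    by metis
  then have "\<forall>x y. A x \<bullet> y = x \<bullet> adjoint A y"
    unfolding adjoint_def by (rule someI_ex)
  then show ?thesis by blast
qed

lemma inv_adjoint_eq:
  fixes A :: "'a::{real_inner, complete_space} \<Rightarrow> 'b::{real_inner, complete_space}"
  assumes "bounded_linear A" "has_bounded_inverse A"
  shows "inv (adjoint A) = adjoint (inv A)"
proof -
  have bij: "bij A" and B: "bounded_linear (inv A)"
    using assms(2) by (auto simp: has_bounded_inverse_def)
  have "adjoint A (adjoint (inv A) x) = x" for x
  proof -
    have "h \<bullet> adjoint A (adjoint (inv A) x) = h \<bullet> x" for h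
      by (simp add: bij_is_inj[OF bij] flip: inner_adjoint[OF assms(1)] inner_adjoint[OF B])
    then show ?thesis by (metis vector_eq_ldot)
  qed
  moreover have "adjoint (inv A) (adjoint A y) = y" for y
  proof -
    have "h \<bullet> adjoint (inv A) (adjoint A y) = h \<bullet> y" for h
      by (simp add: surj_f_inv_f[OF bij_is_surj[OF bij]]
          flip: inner_adjoint[OF assms(1)] inner_adjoint[OF B])
    then show ?thesis by (metis vector_eq_ldot)
  qed
  ultimately show ?thesis
    by (intro inv_equality) auto
qed

section \<open>Differentiability of the solution operator\<close>

text \<open>The expansion of \<open>F\<close> at \<open>T u\<close>, multiplied by \<open>B\<close>, bounds
  \<open>T v - T u - B (q v - q u)\<close> by a small multiple of \<open>T v - T u\<close>; continuity of \<open>T\<close> keeps \<open>T v\<close>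
  where the expansion is valid. With the multiple \<open>1/2\<close> this
  makes \<open>T v - T u\<close> of order \<open>v - u\<close>; inserting that bound again, with an arbitrarily small
  multiple, shows that \<open>T\<close> and \<open>B \<circ> q\<close> have the same derivative at \<open>u\<close>.\<close>

lemma has_derivative_solution_of_equation:
  fixes F :: "'a::real_normed_vector \<Rightarrow> 'b::real_normed_vector"
    and T :: "'c::real_normed_vector \<Rightarrow> 'a"
  assumes F: "(F has_derivative A) (at (T u))"
    and q: "(q has_derivative q') (at u)"
    and eq: "\<And>v. F (T v) = q v"
    and B: "bounded_linear B" and BA: "\<And>h. B (A h) = h"
    and cont: "isCont T u"
  shows "(T has_derivative (\<lambda>h. B (q' h))) (at u)"
proof -
  interpret B: bounded_linear B by fact
  obtain C where C: "C > 0" "\<And>y. norm (B y) \<le> norm y * C"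
    using B.pos_bounded by blast
  have small: "\<forall>\<^sub>F v in at u. norm (T v - T u - B (q v - q u)) \<le> e * norm (T v - T u)"
    if "e > 0" for e
  proof -
    have "e / C > 0" using that C(1) by simp
    then obtain d where "d > 0" and d: "\<And>y. norm (y - T u) < d \<Longrightarrow>
        norm (F y - F (T u) - A (y - T u)) \<le> e / C * norm (y - T u)"
      using F[unfolded has_derivative_at_alt] by blast
    have "\<forall>\<^sub>F v in at u. dist (T v) (T u) < d"
      using cont \<open>d > 0\<close> unfolding isCont_def by (rule tendstoD)
    then show ?thesis
    proof eventually_elim
      case (elim v)
      have "T v - T u - B (q v - q u) = - B (F (T v) - F (T u) - A (T v - T u))"
        by (simp only: B.diff BA eq) simp
      also have "norm \<dots> \<le> norm (F (T v) - F (T u) - A (T v - T u)) * C"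
        using C(2) by simp
      also have "\<dots> \<le> e / C * norm (T v - T u) * C"
        using elim d C(1) by (intro mult_right_mono) (auto simp: dist_norm)
      finally show ?case using C(1) by simp
    qed
  qed
  have Bq: "((\<lambda>v. B (q v)) has_derivative (\<lambda>h. B (q' h))) (at u)"
    using B.has_derivative[OF q] .
  obtain L where L: "L > 0" "\<And>h. norm (B (q' h)) \<le> norm h * L"
    using bounded_linear.pos_bounded[OF has_derivative_bounded_linear[OF Bq]] by blast
  define M where "M = 2 * (L + 1)"
  have "M > 0" using L(1) by (simp add: M_def)
  obtain d where "d > 0" and d: "\<And>v. norm (v - u) < d \<Longrightarrow>
      norm (B (q v) - B (q u) - B (q' (v - u))) \<le> 1 * norm (v - u)"
    using Bq[unfolded has_derivative_at_alt] zero_less_one by blast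
  have "\<forall>\<^sub>F v in at u. dist v u < d"
    using \<open>d > 0\<close> by (rule tendstoD[OF tendsto_ident_at])
  then have lipschitz: "\<forall>\<^sub>F v in at u. norm (T v - T u) \<le> M * norm (v - u)"
    using small[of "1/2", simplified]
  proof eventually_elim
    case (elim v)
    have "norm (B (q v) - B (q u)) \<le> norm (B (q' (v - u))) + 1 * norm (v - u)"
      using d[of v] elim(1) norm_triangle_ineq2[of "B (q v) - B (q u)" "B (q' (v - u))"]
      by (simp add: dist_norm)
    then have "norm (B (q v - q u)) \<le> (L + 1) * norm (v - u)"
      using L(2)[of "v - u"] by (simp add: B.diff algebra_simps)
    moreover have "norm (T v - T u) \<le> 2 * norm (B (q v - q u))"
      using elim(2) norm_triangle_ineq2[of "T v - T u" "B (q v - q u)"] by simp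
    ultimately have "norm (T v - T u) \<le> 2 * ((L + 1) * norm (v - u))" by simp
    then show ?case by (simp only: M_def mult.assoc)
  qed
  have "((\<lambda>v. T v - B (q v)) has_derivative (\<lambda>h. 0)) (at u)"
    unfolding has_derivative_within_alt2
  proof (intro conjI allI impI bounded_linear_zero)
    fix e :: real assume "e > 0"
    then have pos: "e / M > 0" using \<open>M > 0\<close> by simp
    show "\<forall>\<^sub>F v in at u. norm (T v - B (q v) - (T u - B (q u)) - 0) \<le> e * norm (v - u)"
      using small[OF pos] lipschitz
    proof eventually_elim
      case (elim v)
      have "norm (T v - T u - B (q v - q u)) \<le> e / M * (M * norm (v - u))"
        using elim pos by (meson mult_left_mono order_trans less_imp_le)
      then show ?case using \<open>M > 0\<close> by (simp add: B.diff algebra_simps)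
    qed
  qed
  from has_derivative_add[OF this Bq] show ?thesis by simp
qed

section \<open>The optimality system\<close>

lemma strictly_monotone_operator_imp_inj:
  "strictly_monotone_operator A \<Longrightarrow> inj A"
  unfolding strictly_monotone_operator_def inj_def
  by (metis diff_self inner_zero_left less_irrefl)

lemma monotone_linear_nonneg:
  assumes "linear A" "monotone_operator A"
  shows "0 \<le> x \<bullet> A x"
  using assms(2)[unfolded monotone_operator_def, rule_format, of x 0] linear_0[OF assms(1)]
  by (simp add: inner_commute)

lemma strictly_monotone_imp_monotone_operator:
  "strictly_monotone_operator A \<Longrightarrow> monotone_operator A"
  unfolding strictly_monotone_operator_def monotone_operator_def
  by (metis diff_self inner_zero_left less_imp_le order_refl)

text \<open>The real-valued infimum in \<^const>\<open>optimal_pair\<close> carries information only because the cost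
  is bounded below.\<close>

lemma optimal_pair_minimizes:
  assumes "linear R" "monotone_operator R" "linear W" "monotone_operator W"
    and "optimal_pair R W T u x"
  shows "cost R W T u \<le> cost R W T v"
proof -
  have "bdd_below (range (cost R W T))"
    by (rule bdd_belowI2[where m = 0]) (simp add: cost_def monotone_linear_nonneg assms)
  then show ?thesis
    using assms(5) by (simp add: optimal_pair_def cINF_lower)
qed

lemma has_derivative_quadratic_form:
  fixes A :: "'a::real_inner \<Rightarrow> 'a"
  assumes "bounded_linear A" "symmetric_operator A" and f: "(f has_derivative f') (at u)"
  shows "((\<lambda>v. f v \<bullet> A (f v)) has_derivative (\<lambda>h. 2 * (f' h \<bullet> A (f u)))) (at u)"
proof -
  have "((\<lambda>v. f v \<bullet> A (f v)) has_derivative (\<lambda>h. f u \<bullet> A (f' h) + f' h \<bullet> A (f u))) (at u)"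
    by (intro has_derivative_inner f bounded_linear.has_derivative[OF assms(1)])
  moreover have "f u \<bullet> A (f' h) = f' h \<bullet> A (f u)" for h
    using assms(2) by (metis symmetric_operator_def inner_commute)
  ultimately show ?thesis by simp
qed

theorem theorem4p3:
  fixes K N :: "'x::{real_inner, complete_space} \<Rightarrow> 'x"
    and H :: "'z::{real_inner, complete_space} \<Rightarrow> 'x"
    and G :: "'x \<Rightarrow> 'x \<Rightarrow> 'x"
    and R :: "'z \<Rightarrow> 'z"
    and W :: "'x \<Rightarrow> 'x"
    and ustar :: 'z and xstar :: 'x
  assumes "uniquely_solvable K N H"
    and "bounded_linear R" "symmetric_operator R"
      "strictly_monotone_operator R" "coercive_operator R"
    and "bounded_linear W" "symmetric_operator W" "monotone_operator W"
    and "\<forall>x. (K has_derivative K) (at x)"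
    and "\<forall>x. (N has_derivative G x) (at x)"
    and "\<forall>u. (H has_derivative H) (at u)"
    and "\<forall>u. has_bounded_inverse (\<lambda>h. h - K (G (solution_operator K N H u) h))"
    and "isCont (solution_operator K N H) ustar"
    and "optimal_pair R W (solution_operator K N H) ustar xstar"
  shows "xstar = K (N xstar) + H ustar \<and>
    ustar = - inv R (adjoint H (inv (adjoint (\<lambda>h. h - K (G xstar h))) (W xstar)))"
proof
  define T where "T = solution_operator K N H"
  have state: "T v = K (N (T v)) + H v" for v
    unfolding T_def solution_operator_def
    using assms(1)[unfolded uniquely_solvable_def, rule_format, of v] by (rule theI')
  have xstar: "xstar = T ustar"
    using assms(14) by (simp add: optimal_pair_def T_def)
  show "xstar = K (N xstar) + H ustar"
    using state[of ustar] by (simp only: xstar)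

  define A where "A = (\<lambda>h. h - K (G xstar h))"
  have K: "bounded_linear K" and H: "bounded_linear H"
    using assms(9,11) has_derivative_bounded_linear by blast+
  have F: "((\<lambda>x. x - K (N x)) has_derivative A) (at xstar)"
    unfolding A_def
    by (intro has_derivative_diff has_derivative_ident bounded_linear.has_derivative[OF K])
      (simp add: assms(10))
  have A: "bounded_linear A" by (rule has_derivative_bounded_linear[OF F])
  have inv_A: "has_bounded_inverse A"
    using assms(12) by (simp add: A_def xstar T_def)
  then have B: "bounded_linear (inv A)" and "inj A"
    by (auto simp: has_bounded_inverse_def bij_is_inj)

  have T': "(T has_derivative (\<lambda>h. inv A (H h))) (at ustar)"
  proof (rule has_derivative_solution_of_equation[
        where F = "\<lambda>x. x - K (N x)" and A = A and B = "inv A" and q = H])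
    show "((\<lambda>x. x - K (N x)) has_derivative A) (at (T ustar))"
      using F by (simp add: xstar)
    show "T v - K (N (T v)) = H v" for v
      using state[of v] by (simp add: algebra_simps)
    show "inv A (A h) = h" for h
      using \<open>inj A\<close> by simp
  qed (use assms B in \<open>simp_all add: T_def\<close>)
  have "(cost R W T has_derivative
      (\<lambda>h. 2 * (h \<bullet> R ustar) + 2 * (inv A (H h) \<bullet> W (T ustar)))) (at ustar)"
    unfolding cost_def
    by (intro has_derivative_add has_derivative_quadratic_form[OF assms(2,3)]
        has_derivative_quadratic_form[OF assms(6,7)] has_derivative_ident T')
  moreover have "\<forall>v\<in>UNIV. cost R W T ustar \<le> cost R W T v"
    using optimal_pair_minimizes assms
    by (metis T_def bounded_linear.linear strictly_monotone_imp_monotone_operator)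
  ultimately have zero: "(\<lambda>h. 2 * (h \<bullet> R ustar) + 2 * (inv A (H h) \<bullet> W xstar)) = (\<lambda>h. 0)"
    using differential_zero_maxmin[of ustar UNIV "cost R W T"] xstar by blast

  define p where "p = adjoint H (inv (adjoint A) (W xstar))"
  have "h \<bullet> R ustar = h \<bullet> - p" for h
  proof -
    have "h \<bullet> p = inv A (H h) \<bullet> W xstar"
      by (simp add: p_def inv_adjoint_eq[OF A inv_A]
          flip: inner_adjoint[OF H] inner_adjoint[OF B])
    then show ?thesis using fun_cong[OF zero, of h] by simp
  qed
  then have "R ustar = - p" by (metis vector_eq_ldot)
  then have "p = R (- ustar)"
    by (simp add: linear_neg[OF bounded_linear.linear[OF assms(2)]])
  then have "inv R p = - ustar"
    by (simp add: strictly_monotone_operator_imp_inj[OF assms(4)])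
  then show "ustar = - inv R (adjoint H (inv (adjoint (\<lambda>h. h - K (G xstar h))) (W xstar)))"
    by (simp add: p_def A_def)
qed

end
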